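(* For each integer $n\geq 1$, let $f_{n}:[0,1]\rightarrow 2^{[0,1]}$ be a surjective, upper semicontinuous set-valued function that has the Weak Intermediate Value Property and whose graph $G(f_n)$ is connected. Then the inverse limit $$\varprojlim\{[0,1],f_{n}\}=\left\{(x_{0},x_{1},x_2,\dots)\in\prod_{i\geq 0}[0,1] : x_{i-1}\in f_{i}(x_{i})\ \text{for all } i\geq 1\right\}$$ is connected (as a subspace of the product space $\prod_{i\ge 0}[0,1]$).
   Context: $2^{[0,1]}$ denotes the collection of nonempty compact subsets of $[0,1]$. The graph of $f:[0,1]\to 2^{[0,1]}$ is $G(f)=\{(x,y)\in[0,1]\times[0,1]: y\in f(x)\}$. The function $f$ is upper semicontinuous if for every $x$ and every open set $U\supseteq f(x)$ there is an open set $V\ni x$ such that $f(t)\subseteq U$ for all $t\in V$ (equivalently, $G(f)$ is closed). The function $f$ is surjective if for every $y\in[0,1]$ there is $x\in[0,1]$ with $y\in f(x)$. An upper semicontinuous function $f:[0,1]\to 2^{[0,1]}$ has the Weak Intermediate Value Property if, for all distinct $x_{1},x_{2}\in[0,1]$ (in either order) and every $y_{1}\in f(x_{1})$, there is some $y_{2}\in f(x_{2})$ such that for every $y$ between $y_{1}$ and $y_{2}$ there is $x$ between $x_{1}$ and $x_{2}$ with $y\in f(x)$. Here "between" is inclusive of endpoints (i.e. $x$ lies in the closed interval with endpoints $x_1,x_2$, and $y$ in the closed interval with endpoints $y_1,y_2$). *)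

theory Defs
  imports "HOL-Analysis.Analysis"
begin

text \<open>
  A set-valued function from the unit interval to its nonempty compact subsets is represented by
  \<open>f :: real \<Rightarrow> real set\<close>; values of \<open>f\<close> outside the unit interval are irrelevant and
  none of the notions below depends on them.
\<close>

abbreviation unit_interval :: "real set" where
  "unit_interval \<equiv> {0..1}"

definition compact_hyperspace :: "real set set" where
  "compact_hyperspace = {K. K \<noteq> {} \<and> compact K \<and> K \<subseteq> unit_interval}"

definition svf_graph :: "(real \<Rightarrow> real set) \<Rightarrow> (real \<times> real) set" where
  "svf_graph f = {(x, y). x \<in> unit_interval \<and> y \<in> unit_interval \<and> y \<in> f x}"

definition upper_semicontinuous :: "(real \<Rightarrow> real set) \<Rightarrow> bool" where
  "upper_semicontinuous f \<longleftrightarrow>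
     (\<forall>x \<in> unit_interval. \<forall>U. openin (top_of_set unit_interval) U \<and> f x \<subseteq> U \<longrightarrow>
        (\<exists>V. openin (top_of_set unit_interval) V \<and> x \<in> V \<and> (\<forall>t\<in>V. f t \<subseteq> U)))"

definition svf_surjective :: "(real \<Rightarrow> real set) \<Rightarrow> bool" where
  "svf_surjective f \<longleftrightarrow> (\<forall>y \<in> unit_interval. \<exists>x \<in> unit_interval. y \<in> f x)"

text \<open>
  On the reals, \<open>closed_segment a b\<close> is the closed interval with endpoints \<open>a\<close> and \<open>b\<close>
  in either order, that is, inclusive betweenness.
\<close>

definition weak_intermediate_value_property :: "(real \<Rightarrow> real set) \<Rightarrow> bool" where
  "weak_intermediate_value_property f \<longleftrightarrow>
     (\<forall>x1 \<in> unit_interval. \<forall>x2 \<in> unit_interval. x1 \<noteq> x2 \<longrightarrow>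
        (\<forall>y1 \<in> f x1. \<exists>y2 \<in> f x2.
           \<forall>y \<in> closed_segment y1 y2. \<exists>x \<in> closed_segment x1 x2. y \<in> f x))"

definition hilbert_cube :: "(nat \<Rightarrow> real) topology" where
  "hilbert_cube = product_topology (\<lambda>i. top_of_set unit_interval) UNIV"

text \<open>The bonding functions are \<open>f 1, f 2, \<dots>\<close>; the value \<open>f 0\<close> is not used.\<close>

definition inverse_limit :: "(nat \<Rightarrow> real \<Rightarrow> real set) \<Rightarrow> (nat \<Rightarrow> real) set" where
  "inverse_limit f = {x \<in> topspace hilbert_cube. \<forall>i\<ge>1. x (i - 1) \<in> f i (x i)}"

end

theory Submission
  imports Defs
begin

text \<open>
  The weak intermediate value property says that the projection of the graph to the first
  coordinate is confluent: every closed-open part of the graph over an interval projects onto the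
  whole interval. Hence two closed-open parts over an interval that agree in one fibre are equal,
  and closed-open parts of fibres admit unique continuation, like germs of sections of a Hausdorff
  local homeomorphism.

  Let \<open>H\<close> be a continuum mapped by \<open>\<phi>\<close> onto the unit interval, and split the fibre product of \<open>H\<close>
  with the graph of \<open>f\<close> over the unit interval into closed sets \<open>C\<close> and \<open>D\<close>. Near each point of
  \<open>H\<close>, the part \<open>C\<close> is pulled back from a closed-open part of the graph. As \<open>H\<close> is connected, the
  fibres of \<open>C\<close> over any two points of \<open>H\<close> are continuations of each other along the interval; for
  points over 0 and 1 this gives a closed-open part of the whole graph, which is trivial because
  the graph is connected. So \<open>C\<close> or \<open>D\<close> is empty.

  The sequences satisfying the first \<open>n + 1\<close> constraints are the fibre product of the graph of
  \<open>f\<^sub>1\<close> with the sequences satisfying \<open>n\<close> constraints for the shifted system, so they form a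
  continuum by induction, and the inverse limit is a nested intersection of these.
\<close>

section \<open>Upper semicontinuity and compactness of the graph\<close>

locale weak_ivp_svf =
  fixes F :: "real \<Rightarrow> real set"
  assumes hyperspace: "F \<in> unit_interval \<rightarrow> compact_hyperspace"
    and usc: "upper_semicontinuous F"
    and weak_ivp: "weak_intermediate_value_property F"
begin

lemma compact_value: "x \<in> unit_interval \<Longrightarrow> compact (F x)"
  and value_subset: "x \<in> unit_interval \<Longrightarrow> F x \<subseteq> unit_interval"
  using hyperspace by (auto simp: compact_hyperspace_def Pi_iff)

lemma svf_graph_iff: "(x, y) \<in> svf_graph F \<longleftrightarrow> x \<in> unit_interval \<and> y \<in> F x"
  unfolding svf_graph_def mem_Collect_eq case_prod_conv using value_subset by blast

lemma usc_ball:
  assumes x: "x \<in> unit_interval" and U: "open U" "F x \<subseteq> U"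
  obtains d where "d > 0" "\<And>t. t \<in> unit_interval \<Longrightarrow> \<bar>t - x\<bar> < d \<Longrightarrow> F t \<subseteq> U"
proof -
  have "openin (top_of_set unit_interval) (unit_interval \<inter> U)" "F x \<subseteq> unit_interval \<inter> U"
    using U value_subset[OF x] by auto
  then obtain V where V: "openin (top_of_set unit_interval) V" "x \<in> V"
      "\<forall>t\<in>V. F t \<subseteq> unit_interval \<inter> U"
    using usc x unfolding upper_semicontinuous_def by meson
  then obtain d where "d > 0" "ball x d \<inter> unit_interval \<subseteq> V"
    by (meson openin_contains_ball)
  moreover have "t \<in> ball x d" if "\<bar>t - x\<bar> < d" for t
    using that by (simp add: dist_real_def abs_minus_commute)
  ultimately show ?thesis
    using V by (intro that[of d]) blast+
qed

text \<open>If a limit \<open>(x, y)\<close> had \<open>y \<notin> F x\<close>, a closed ball around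
  \<open>y\<close> would miss \<open>F x\<close>. Upper semicontinuity keeps the nearby values out
  of that ball, against convergence.\<close>

lemma compact_svf_graph: "compact (svf_graph F)"
proof -
  have "p \<in> svf_graph F" if lim: "\<forall>n. q n \<in> svf_graph F" "q \<longlonglongrightarrow> p" for p q
  proof -
    obtain x y where p: "p = (x, y)" by fastforce
    have q1: "(\<lambda>n. fst (q n)) \<longlonglongrightarrow> x" and q2: "(\<lambda>n. snd (q n)) \<longlonglongrightarrow> y"
      using tendsto_fst[OF lim(2)] tendsto_snd[OF lim(2)] p by auto
    have qn: "fst (q n) \<in> unit_interval" "snd (q n) \<in> F (fst (q n))" for n
      using lim(1) svf_graph_iff by (metis prod.collapse)+
    have x: "x \<in> unit_interval"
      using closed_sequentially[OF closed_atLeastAtMost _ q1] qn by blast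
    have "y \<in> F x"
    proof (rule ccontr)
      assume "y \<notin> F x"
      then obtain e where e: "e > 0" "\<forall>z\<in>F x. e \<le> dist y z"
        using separate_point_closed compact_imp_closed compact_value[OF x] by metis
      then have "F x \<subseteq> - cball y (e/2)" by force
      then obtain d where d: "d > 0"
          "\<And>t. t \<in> unit_interval \<Longrightarrow> \<bar>t - x\<bar> < d \<Longrightarrow> F t \<subseteq> - cball y (e/2)"
        by (meson usc_ball x open_Compl closed_cball)
      have "\<forall>\<^sub>F n in sequentially. dist (fst (q n)) x < d \<and> dist (snd (q n)) y < e/2"
        using tendstoD[OF q1 d(1)] tendstoD[OF q2, of "e/2"] e(1) by (intro eventually_conj) auto
      then obtain n where "dist (fst (q n)) x < d" "dist (snd (q n)) y < e/2"
        by (auto dest: eventually_happens)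
      with d(2)[OF qn(1)] qn(2) show False
        by (force simp: dist_real_def abs_minus_commute)
    qed
    with x p svf_graph_iff show ?thesis by simp
  qed
  then have "closed (svf_graph F)"
    by (auto simp: closed_sequential_limits)
  moreover have "svf_graph F \<subseteq> unit_interval \<times> unit_interval"
    by (auto simp: svf_graph_def)
  ultimately show ?thesis
    using compact_Times[OF compact_Icc compact_Icc] closed_Int_compact inf.absorb1 by metis
qed

section \<open>Closed-open parts of the graph over an interval\<close>

text \<open>Compactness of both parts makes each closed and open in the graph over \<open>J\<close>.
  The set \<open>J\<close> may stick out of the unit interval, as the balls in
  \<open>local_splits\<close> do.\<close>

definition splits :: "real set \<Rightarrow> (real \<times> real) set \<Rightarrow> (real \<times> real) set \<Rightarrow> bool" where
  "splits J A B \<longleftrightarrow> compact A \<and> compact B \<and> A \<inter> B = {} \<and> A \<union> B = svf_graph F \<inter> (J \<times> UNIV)"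

lemma splits_commute: "splits J A B \<Longrightarrow> splits J B A"
  by (auto simp: splits_def)

lemma splits_in:
  assumes "splits J A B" "(x, y) \<in> A"
  shows "x \<in> J" "x \<in> unit_interval" "y \<in> F x"
proof -
  have "(x, y) \<in> svf_graph F \<inter> (J \<times> UNIV)"
    using assms unfolding splits_def by blast
  then show "x \<in> J" "x \<in> unit_interval" "y \<in> F x"
    using svf_graph_iff by auto
qed

lemma splits_restrict:
  assumes s: "splits J A B" and J': "J' \<subseteq> J" "closed J'"
  shows "splits J' (A \<inter> (J' \<times> UNIV)) (B \<inter> (J' \<times> UNIV))"
proof -
  have "closed (J' \<times> (UNIV :: real set))" by (simp add: closed_Times J')
  with s J' show ?thesis
    by (auto simp: splits_def intro!: compact_Int_closed)
qed

text \<open>A nearby fibre cannot lie in \<open>B\<close> alone: below the distance of \<open>A\<close> and \<open>B\<close>, their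
  projections to the second coordinate are disjoint, so the segment provided by the weak
  intermediate value property stays in the projection of \<open>A\<close>.\<close>

lemma splits_fst_open:
  assumes s: "splits J A B" and J: "is_interval J"
    and d: "\<forall>p\<in>A. \<forall>q\<in>B. d \<le> dist p q"
    and A: "(x0, y0) \<in> A" and x: "x \<in> J" "x \<in> unit_interval" "\<bar>x - x0\<bar> < d"
  obtains y where "(x, y) \<in> A"
proof (cases "x = x0")
  case True
  with A that show ?thesis by blast
next
  case False
  note x0 = splits_in[OF s A]
  obtain y1 where y1: "y1 \<in> F x"
      "\<forall>y \<in> closed_segment y0 y1. \<exists>w \<in> closed_segment x0 x. y \<in> F w"
    using weak_ivp x0 x False unfolding weak_intermediate_value_property_def by metis
  let ?S = "closed_segment x0 x \<times> (UNIV :: real set)"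
  have seg: "closed_segment x0 x \<subseteq> J \<inter> unit_interval"
    using J x0 x by (simp add: closed_segment_subset is_interval_convex convex_real_interval)
  have near: "w \<in> closed_segment x0 x \<Longrightarrow> w' \<in> closed_segment x0 x \<Longrightarrow> \<bar>w - w'\<bar> < d" for w w'
    using x by (auto simp: closed_segment_eq_real_ivl split: if_splits)
  have AB: "A \<union> B = svf_graph F \<inter> (J \<times> UNIV)"
    using s by (simp add: splits_def)
  have clS: "closed ?S" by (simp add: closed_Times)
  then have "compact (A \<inter> ?S)" "compact (B \<inter> ?S)"
    using s by (auto simp: splits_def intro: compact_Int_closed)
  then have cl: "closed (snd ` (A \<inter> ?S))" "closed (snd ` (B \<inter> ?S))"
    by (auto intro!: compact_imp_closed compact_continuous_image continuous_on_snd continuous_on_id)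
  have disj: "snd ` (A \<inter> ?S) \<inter> snd ` (B \<inter> ?S) = {}"
  proof -
    have False if "(w, y) \<in> A" "(w', y) \<in> B" "w \<in> closed_segment x0 x" "w' \<in> closed_segment x0 x"
      for w w' y
      using d that near[of w w'] by (force simp: dist_Pair_Pair dist_real_def)
    then show ?thesis by fastforce
  qed
  have cover: "closed_segment y0 y1 \<subseteq> snd ` (A \<inter> ?S) \<union> snd ` (B \<inter> ?S)"
  proof
    fix y assume "y \<in> closed_segment y0 y1"
    then obtain w where w: "w \<in> closed_segment x0 x" "y \<in> F w" using y1 by blast
    then have "(w, y) \<in> A \<union> B" using AB seg svf_graph_iff by auto
    with w show "y \<in> snd ` (A \<inter> ?S) \<union> snd ` (B \<inter> ?S)" by force
  qed
  have "y0 \<in> snd ` (A \<inter> ?S)" using A by force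
  then have "snd ` (B \<inter> ?S) \<inter> closed_segment y0 y1 = {}"
    using connected_closedD[OF connected_segment _ cover cl] disj by blast
  then have "(x, y1) \<notin> B"
    by force
  moreover have "(x, y1) \<in> A \<union> B"
    using AB x y1 svf_graph_iff by auto
  ultimately show ?thesis using that by blast
qed

text \<open>The distance \<open>d\<close> between \<open>A\<close> and \<open>B\<close> is a uniform
  step for \<open>splits_fst_open\<close>, so membership in the projection of \<open>A\<close> is
  locally constant on the connected set \<open>J\<close>.\<close>

lemma splits_full_projection:
  assumes s: "splits J A B" and J: "is_interval J" "J \<subseteq> unit_interval"
    and "A \<noteq> {}" and x: "x \<in> J"
  obtains y where "(x, y) \<in> A"
proof -
  obtain d where d: "d > 0" "\<forall>p\<in>A. \<forall>q\<in>B. d \<le> dist p q"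
    using s separate_compact_closed[of A B] compact_imp_closed by (auto simp: splits_def)
  obtain x0 y0 where A: "(x0, y0) \<in> A" using \<open>A \<noteq> {}\<close> by fastforce
  have near: "b \<in> fst ` A" if a: "a \<in> fst ` A" and b: "b \<in> J" "\<bar>b - a\<bar> < d" for a b
  proof -
    obtain y where "(a, y) \<in> A" using a by force
    then obtain z where "(b, z) \<in> A"
      using splits_fst_open[OF s J(1) d(2)] b J(2) by blast
    then show ?thesis by force
  qed
  have "connected J" using J by (simp add: is_interval_connected_1)
  then have "(x0 \<in> fst ` A) = (x \<in> fst ` A)"
  proof (rule connected_equivalence_relation)
    show "x0 \<in> J" using splits_in[OF s A] by blast
    show "\<exists>T. openin (top_of_set J) T \<and> a \<in> T \<and> (\<forall>x\<in>T. (a \<in> fst ` A) = (x \<in> fst ` A))"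
      if a: "a \<in> J" for a
    proof (intro exI conjI ballI)
      show "openin (top_of_set J) (J \<inter> ball a d)" by blast
      show "a \<in> J \<inter> ball a d" using a d by simp
      fix b assume b: "b \<in> J \<inter> ball a d"
      then have "\<bar>b - a\<bar> < d" "\<bar>a - b\<bar> < d" by (auto simp: dist_real_def)
      with near[of a b] near[of b a] a b show "(a \<in> fst ` A) = (b \<in> fst ` A)" by blast
    qed
  qed (use x in auto)
  with A that show ?thesis by force
qed

lemma splits_unique:
  assumes s: "splits J A B" "splits J A' B'" and J: "is_interval J" "J \<subseteq> unit_interval"
    and x: "x \<in> J" and eq: "\<And>y. (x, y) \<in> A \<longleftrightarrow> (x, y) \<in> A'"
  shows "A = A'"
proof -
  have sub: "A \<subseteq> A'"
    if s: "splits J A B" "splits J A' B'" and eq: "\<And>y. (x, y) \<in> A \<longleftrightarrow> (x, y) \<in> A'" for A B A' B'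
  proof -
    \<comment> \<open>The difference of \<open>A\<close> and \<open>A'\<close> is itself a
      closed-open part; its fibre over \<open>x\<close> is empty, so all of it is.\<close>
    have "splits J (A \<inter> B') (B \<union> (A \<inter> A'))"
      using s by (auto simp: splits_def intro: compact_Int compact_Un)
    moreover have "(x, y) \<notin> A \<inter> B'" for y
      using eq s by (auto simp: splits_def)
    ultimately have "A \<inter> B' = {}"
      using splits_full_projection[OF _ J _ x] by metis
    with s show ?thesis unfolding splits_def by blast
  qed
  show ?thesis using sub[OF s eq] sub[OF s(2,1)] eq by blast
qed

section \<open>Continuation of fibre parts along segments\<close>

text \<open>Analogue of continuing a germ of a section along a path, with closed-open parts of
  fibres as germs. For \<open>x = x'\<close> it forces \<open>K = K'\<close>.\<close>

definition continues :: "real \<Rightarrow> real set \<Rightarrow> real \<Rightarrow> real set \<Rightarrow> bool" where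
  "continues x K x' K' \<longleftrightarrow> (\<exists>A B. splits (closed_segment x x') A B
     \<and> K = {y. (x, y) \<in> A} \<and> K' = {y. (x', y) \<in> A})"

lemma continues_sym: "continues x K x' K' \<Longrightarrow> continues x' K' x K"
  unfolding continues_def by (metis closed_segment_commute)

lemma continues_splits:
  assumes "splits J A B" "is_interval J" "x \<in> J" "x' \<in> J"
  shows "continues x {y. (x, y) \<in> A} x' {y. (x', y) \<in> A}"
proof -
  have "closed_segment x x' \<subseteq> J"
    using assms by (simp add: closed_segment_subset is_interval_convex)
  from splits_restrict[OF assms(1) this closed_segment] show ?thesis
    unfolding continues_def by fastforce
qed

text \<open>Both parts have the fibre \<open>K'\<close> over \<open>x'\<close>, so by
  \<open>splits_unique\<close> they agree over the overlap of the segments and can be glued. The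
  three points may lie in any order.\<close>

lemma continues_trans:
  assumes "continues x K x' K'" "continues x' K' x'' K''"
    and I: "x \<in> unit_interval" "x' \<in> unit_interval" "x'' \<in> unit_interval"
  shows "continues x K x'' K''"
proof -
  let ?S = "closed_segment x x'" and ?T = "closed_segment x' x''"
  from assms obtain A B C D where s: "splits ?S A B" "splits ?T C D"
    and K: "K = {y. (x, y) \<in> A}" "K' = {y. (x', y) \<in> A}" "K' = {y. (x', y) \<in> C}" "K'' = {y. (x'', y) \<in> C}"
    unfolding continues_def by metis
  let ?R = "(?S \<inter> ?T) \<times> (UNIV :: real set)"
  have "is_interval ?S" "is_interval ?T" "is_interval (?S \<inter> ?T)"
    by (auto simp: is_interval_convex_1 intro: convex_Int)
  have IS: "?S \<subseteq> unit_interval" "?T \<subseteq> unit_interval"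
    using I by (simp_all add: closed_segment_subset)
  have AC: "A \<inter> ?R = C \<inter> ?R"
  proof (rule splits_unique)
    show "splits (?S \<inter> ?T) (A \<inter> ?R) (B \<inter> ?R)" "splits (?S \<inter> ?T) (C \<inter> ?R) (D \<inter> ?R)"
      by (rule splits_restrict[OF s(1)]; simp add: closed_Int)
        (rule splits_restrict[OF s(2)]; simp add: closed_Int)
    show "x' \<in> ?S \<inter> ?T" by simp
    show "(x', y) \<in> A \<inter> ?R \<longleftrightarrow> (x', y) \<in> C \<inter> ?R" for y
      using K by auto
  qed (use \<open>is_interval (?S \<inter> ?T)\<close> IS in auto)
  have "splits (?S \<union> ?T) (A \<union> C) (B \<union> D)"
  proof -
    \<comment> \<open>A point of both \<open>A\<close> and \<open>D\<close> lies over the overlap,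
      where \<open>A\<close> and \<open>C\<close> coincide.\<close>
    have "p \<notin> D" if "p \<in> A" for p
    proof
      assume "p \<in> D"
      with that s have "p \<in> ?R" by (cases p) (auto dest: splits_in splits_in[OF splits_commute])
      with that AC have "p \<in> C" by blast
      with \<open>p \<in> D\<close> s show False by (auto simp: splits_def)
    qed
    moreover have "p \<notin> C" if "p \<in> B" for p
    proof
      assume "p \<in> C"
      with that s have "p \<in> ?R" by (cases p) (auto dest: splits_in splits_in[OF splits_commute])
      with \<open>p \<in> C\<close> AC have "p \<in> A" by blast
      with that s show False by (auto simp: splits_def)
    qed
    moreover have "A \<union> B = svf_graph F \<inter> (?S \<times> UNIV)" "C \<union> D = svf_graph F \<inter> (?T \<times> UNIV)"
      using s by (simp_all add: splits_def)
    then have "(A \<union> C) \<union> (B \<union> D) = svf_graph F \<inter> ((?S \<union> ?T) \<times> UNIV)"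
      by (simp only: Sigma_Un_distrib1 Int_Un_distrib Un_ac flip: Un_assoc)
    ultimately show ?thesis
      using s unfolding splits_def by (blast intro: compact_Un)
  qed
  moreover have "is_interval (?S \<union> ?T)"
    by (auto simp: is_interval_connected_1 intro!: connected_Un)
  \<comment> \<open>A point of \<open>C\<close> over \<open>x\<close> lies over the overlap, hence
    is already in \<open>A\<close>.\<close>
  moreover have "{y. (x, y) \<in> A \<union> C} = K"
    using AC K(1) splits_in(1)[OF s(2), of x] by auto
  moreover have "{y. (x'', y) \<in> A \<union> C} = K''"
    using AC K(4) splits_in(1)[OF s(1), of x''] by auto
  ultimately show ?thesis
    using continues_splits[of "?S \<union> ?T" "A \<union> C" "B \<union> D" x x''] by simp
qed

section \<open>Connectedness of fibre products\<close>

text \<open>Nearby fibres stay inside \<open>U \<union> V\<close>. Cutting with the complements of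
  \<open>V\<close> and \<open>U\<close>, instead of with \<open>U\<close> and \<open>V\<close>,
  makes both parts visibly closed.\<close>

lemma local_splits:
  assumes x: "x \<in> unit_interval" and UV: "open U" "open V" "U \<inter> V = {}" "F x \<subseteq> U \<union> V"
  obtains d where "d > 0"
    "splits (cball x d) (svf_graph F \<inter> cball x d \<times> (- V)) (svf_graph F \<inter> cball x d \<times> (- U))"
proof -
  obtain d where d: "d > 0" "\<And>t. t \<in> unit_interval \<Longrightarrow> \<bar>t - x\<bar> < d \<Longrightarrow> F t \<subseteq> U \<union> V"
    using usc_ball[OF x _ UV(4)] UV by blast
  \<comment> \<open>The radius is halved because \<open>d\<close> controls only distances below
    \<open>d\<close>, while the ball is closed.\<close>
  have sub: "y \<in> U \<union> V" if "(t, y) \<in> svf_graph F" "t \<in> cball x (d/2)" for t y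
  proof -
    have "\<bar>t - x\<bar> < d" using that(2) d(1) unfolding mem_cball dist_real_def by linarith
    with d(2)[of t] that svf_graph_iff show ?thesis by blast
  qed
  have "compact (svf_graph F \<inter> cball x (d/2) \<times> (- V))" "compact (svf_graph F \<inter> cball x (d/2) \<times> (- U))"
    using UV by (auto intro!: compact_Int_closed compact_svf_graph closed_Times closed_Compl)
  then have "splits (cball x (d/2)) (svf_graph F \<inter> cball x (d/2) \<times> (- V))
      (svf_graph F \<inter> cball x (d/2) \<times> (- U))"
    using sub UV(3) unfolding splits_def by blast
  with d(1) show ?thesis by (intro that[of "d/2"]) auto
qed

text \<open>This drives the induction, with \<open>\<phi>\<close> the first coordinate of a
  sequence. The map \<open>\<phi>\<close> may run back and forth; transitivity of
  \<open>continues\<close> for points in any order absorbs this.\<close>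

lemma connected_fibre_product:
  fixes H :: "'a :: t2_space set" and \<phi> :: "'a \<Rightarrow> real"
  assumes H: "compact H" "connected H" and \<phi>: "continuous_on H \<phi>" "\<phi> ` H = unit_interval"
    and graph: "connected (svf_graph F)"
    and P: "compact {(h, y). h \<in> H \<and> y \<in> F (\<phi> h)}"
  shows "connected {(h, y). h \<in> H \<and> y \<in> F (\<phi> h)}" (is "connected ?P")
proof (rule ccontr)
  assume "\<not> connected ?P"
  then obtain C D where CD: "closed C" "closed D" "C \<noteq> {}" "D \<noteq> {}" "C \<union> D = ?P" "C \<inter> D = {}"
    using connected_closed_set[OF compact_imp_closed[OF P]] by blast
  then have cpt: "compact C" "compact D"
    using compact_Int_closed[OF P CD(1)] compact_Int_closed[OF P CD(2)]
    by (simp_all add: Int_absorb1 flip: CD(5))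
  define K where "K h = {y. (h, y) \<in> C}" for h
  define L where "L h = {y. (h, y) \<in> D}" for h
  have KL: "K h \<union> L h = F (\<phi> h)" "K h \<inter> L h = {}" if "h \<in> H" for h
    using CD that by (auto simp: K_def L_def)
  have I: "\<phi> h \<in> unit_interval" if "h \<in> H" for h using that \<phi> by blast
  have local: "\<exists>T. openin (top_of_set H) T \<and> a \<in> T \<and> (\<forall>b\<in>T. continues (\<phi> a) (K a) (\<phi> b) (K b))"
    if a: "a \<in> H" for a
  proof -
    have "closed (K a)" "closed (L a)"
      using closed_vimage[OF CD(1), of "Pair a"] closed_vimage[OF CD(2), of "Pair a"]
      by (simp_all add: K_def L_def vimage_def continuous_intros)
    then obtain U V where UV: "open U" "open V" "U \<inter> V = {}" "K a \<subseteq> U" "L a \<subseteq> V"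
      using KL(2)[OF a] t4_space[of "K a" "L a"] by blast
    then obtain d where d: "d > 0" and
      s: "splits (cball (\<phi> a) d) (svf_graph F \<inter> cball (\<phi> a) d \<times> (- V))
            (svf_graph F \<inter> cball (\<phi> a) d \<times> (- U))"
      using local_splits[OF I[OF a] UV(1-3)] KL(1)[OF a] UV(4,5) by blast
    \<comment> \<open>\<open>?N C U\<close> consists of the \<open>h\<close> with \<open>K h\<close>
      not inside \<open>U\<close>; \<open>?N D V\<close> does the same for \<open>L\<close> and
      \<open>V\<close>. Both are closed by compactness and avoid \<open>a\<close>, as in the tube
      lemma.\<close>
    let ?N = "\<lambda>C U. fst ` (C \<inter> UNIV \<times> (- U))"
    have "closed (?N C U)" if "compact C" "open U" for C :: "('a \<times> real) set" and U
    proof -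
      have "compact (C \<inter> UNIV \<times> (- U))"
        using that by (intro compact_Int_closed closed_Times closed_UNIV closed_Compl)
      then show ?thesis
        by (intro compact_imp_closed compact_continuous_image continuous_on_fst continuous_on_id)
    qed
    then have "open (- (?N C U \<union> ?N D V))"
      using cpt UV by (intro open_Compl closed_Un) blast+
    then have "openin (top_of_set H) (H \<inter> \<phi> -` ball (\<phi> a) d \<inter> - (?N C U \<union> ?N D V))"
      by (rule openin_Int_open[OF continuous_openin_preimage_gen[OF \<phi>(1) open_ball]])
    moreover have "a \<in> H \<inter> \<phi> -` ball (\<phi> a) d \<inter> - (?N C U \<union> ?N D V)"
      using a d UV(4,5) by (auto simp: K_def L_def)
    moreover have "continues (\<phi> a) (K a) (\<phi> b) (K b)"
      if b: "b \<in> H \<inter> \<phi> -` ball (\<phi> a) d \<inter> - (?N C U \<union> ?N D V)" for b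
    proof -
      \<comment> \<open>Under these inclusions \<open>K b\<close> is the part of
        \<open>F (\<phi> b)\<close> outside \<open>V\<close>, so near \<open>a\<close> it depends on
        \<open>b\<close> only through \<open>\<phi> b\<close>.\<close>
      have sec: "K b = {y. (\<phi> b, y) \<in> svf_graph F \<inter> cball (\<phi> a) d \<times> (- V)}"
        if "b \<in> H" "K b \<subseteq> U" "L b \<subseteq> V" "\<phi> b \<in> cball (\<phi> a) d" for b
      proof -
        have "K b = F (\<phi> b) \<inter> - V" using KL[OF \<open>b \<in> H\<close>] that(2,3) UV(3) by blast
        then show ?thesis using svf_graph_iff I[OF \<open>b \<in> H\<close>] that(4) by auto
      qed
      have "K b \<subseteq> U" "L b \<subseteq> V"
        using b unfolding K_def L_def by force+
      moreover have "\<phi> b \<in> cball (\<phi> a) d" "b \<in> H" using b by auto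
      ultimately show ?thesis
        using continues_splits[OF s, of "\<phi> a" "\<phi> b"] sec[of a] sec[of b] a UV d
        by (simp add: is_interval_cball_1)
    qed
    ultimately show ?thesis by blast
  qed
  have cont: "continues (\<phi> a) (K a) (\<phi> b) (K b)" if "a \<in> H" "b \<in> H" for a b
    using H(2) that
  proof (rule connected_equivalence_relation)
    show "continues (\<phi> x) (K x) (\<phi> z) (K z)"
      if "continues (\<phi> x) (K x) (\<phi> y) (K y)" "continues (\<phi> y) (K y) (\<phi> z) (K z)"
        "x \<in> H" "y \<in> H" "z \<in> H" for x y z
      using that continues_trans I by blast
  qed (use local continues_sym in auto)
  \<comment> \<open>The segment between these two values is the whole unit interval, so the
    resulting split is one of the whole connected graph.\<close>
  obtain h0 h1 where h: "h0 \<in> H" "h1 \<in> H" "\<phi> h0 = 0" "\<phi> h1 = 1"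
  proof -
    have "0 \<in> \<phi> ` H" "1 \<in> \<phi> ` H" using \<phi>(2) by auto
    with that show ?thesis by auto
  qed
  obtain A B where s: "splits unit_interval A B" and A: "K h0 = {y. (0, y) \<in> A}"
    using cont[OF h(1,2)] h unfolding continues_def by (auto simp: closed_segment_eq_real_ivl)
  have "A \<union> B = svf_graph F" "A \<inter> B = {}" "closed A" "closed B"
    using s by (auto simp: splits_def svf_graph_def compact_imp_closed)
  then have "A = {} \<or> B = {}"
    using graph connected_as_closed_union by metis
  then have triv: "K h0 = {} \<or> L h0 = {}"
  proof
    assume "A = {}"
    with A show ?thesis by simp
  next
    assume "B = {}"
    with \<open>A \<union> B = svf_graph F\<close> A have "K h0 = {y. (0, y) \<in> svf_graph F}" by simp
    also have "\<dots> = F (\<phi> h0)" using svf_graph_iff h(3) by simp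
    finally show ?thesis using KL[OF h(1)] by blast
  qed
  \<comment> \<open>A nonempty part over a segment meets every fibre, so emptiness spreads from
    \<open>h0\<close> to all of \<open>H\<close> and makes \<open>C\<close> or \<open>D\<close>
    empty.\<close>
  have all: "K b = {} \<longleftrightarrow> K a = {}" "L b = {} \<longleftrightarrow> L a = {}" if ab: "a \<in> H" "b \<in> H" for a b
  proof -
    obtain A B where s: "splits (closed_segment (\<phi> a) (\<phi> b)) A B"
      and A: "K a = {y. (\<phi> a, y) \<in> A}" "K b = {y. (\<phi> b, y) \<in> A}"
      using cont[OF ab] unfolding continues_def by blast
    have J: "is_interval (closed_segment (\<phi> a) (\<phi> b))" "closed_segment (\<phi> a) (\<phi> b) \<subseteq> unit_interval"
      using I ab by (auto simp: is_interval_convex_1 closed_segment_subset)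
    have AB: "A \<inter> B = {}" "A \<union> B = svf_graph F \<inter> (closed_segment (\<phi> a) (\<phi> b) \<times> UNIV)"
      using s by (auto simp: splits_def)
    have L_eq: "L h = {y. (\<phi> h, y) \<in> B}"
      if "h \<in> H" "\<phi> h \<in> closed_segment (\<phi> a) (\<phi> b)" "K h = {y. (\<phi> h, y) \<in> A}" for h
    proof -
      have "(\<phi> h, y) \<in> A \<union> B \<longleftrightarrow> y \<in> F (\<phi> h)" for y
        unfolding AB(2) using svf_graph_iff I[OF that(1)] that(2) by simp
      with KL[OF that(1)] that(3) AB(1) show ?thesis by blast
    qed
    have B: "L a = {y. (\<phi> a, y) \<in> B}" "L b = {y. (\<phi> b, y) \<in> B}"
      using L_eq[of a] L_eq[of b] ab A by simp_all
    have fibre_empty: "{y. (x, y) \<in> E} = {} \<longleftrightarrow> E = {}"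
      if E: "splits (closed_segment (\<phi> a) (\<phi> b)) E E'"
        and x: "x \<in> closed_segment (\<phi> a) (\<phi> b)" for E E' x
    proof (cases "E = {}")
      case False
      then obtain y where "(x, y) \<in> E"
        using splits_full_projection[OF E J _ x] by metis
      then show ?thesis by auto
    qed simp
    show "K b = {} \<longleftrightarrow> K a = {}" "L b = {} \<longleftrightarrow> L a = {}"
      using A B fibre_empty[OF s] fibre_empty[OF splits_commute[OF s]] by simp_all
  qed
  have "K h \<noteq> {}" "h \<in> H" if "(h, y) \<in> C" for h y using that CD by (auto simp: K_def)
  moreover have "L h \<noteq> {}" "h \<in> H" if "(h, y) \<in> D" for h y using that CD by (auto simp: L_def)
  ultimately show False
    using triv all h(1) CD(3,4) by (metis equals0I surj_pair)
qed

end

section \<open>Sequences satisfying finitely many constraints\<close>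

text \<open>The bonding functions are indexed from 0 here: \<open>g i\<close> stands for \<open>f (Suc i)\<close>.\<close>

definition partial_limit :: "(nat \<Rightarrow> real \<Rightarrow> real set) \<Rightarrow> nat \<Rightarrow> (nat \<Rightarrow> real) set" where
  "partial_limit g n = {x. (\<forall>i. x i \<in> unit_interval) \<and> (\<forall>i<n. x i \<in> g i (x (Suc i)))}"

lemma cube_eq_PiE: "{x :: nat \<Rightarrow> real. \<forall>i. x i \<in> unit_interval} = PiE UNIV (\<lambda>_. unit_interval)"
  by auto

lemma compact_cube: "compact {x :: nat \<Rightarrow> real. \<forall>i. x i \<in> unit_interval}"
  unfolding cube_eq_PiE compactin_euclidean_iff[symmetric] euclidean_product_topology[symmetric]
  by (simp add: compactin_PiE)

lemma connected_cube: "connected {x :: nat \<Rightarrow> real. \<forall>i. x i \<in> unit_interval}"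
  unfolding cube_eq_PiE connectedin_iff_connected[symmetric] euclidean_product_topology[symmetric]
  by (simp add: connectedin_PiE)

lemma compact_partial_limit:
  assumes "\<And>i. weak_ivp_svf (g i)"
  shows "compact (partial_limit g n)"
proof -
  \<comment> \<open>The coordinates are swapped because the graph lists the argument first.\<close>
  have "closed ((\<lambda>x. (x (Suc i), x i)) -` svf_graph (g i))" for i
    using weak_ivp_svf.compact_svf_graph[OF assms]
    by (intro closed_vimage compact_imp_closed continuous_intros) auto
  moreover have "partial_limit g n = {x. (\<forall>i. x i \<in> unit_interval)}
      \<inter> (\<Inter>i<n. (\<lambda>x. (x (Suc i), x i)) -` svf_graph (g i))"
    by (auto simp: partial_limit_def svf_graph_def)
  ultimately show ?thesis
    using compact_cube by (auto intro!: compact_Int_closed)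
qed

lemma partial_limit_coordinate:
  assumes "\<And>i. svf_surjective (g i)"
  shows "(\<lambda>x. x 0) ` partial_limit g n = unit_interval"
proof -
  have "t \<in> (\<lambda>x. x 0) ` partial_limit g n" if t: "t \<in> unit_interval" for t
  proof -
    obtain c where c: "\<And>i y. y \<in> unit_interval \<Longrightarrow> c i y \<in> unit_interval \<and> y \<in> g i (c i y)"
      using assms unfolding svf_surjective_def by metis
    \<comment> \<open>\<open>c i y\<close> is a chosen preimage of \<open>y\<close> under
      \<open>g i\<close>; iterating from \<open>t\<close> meets the constraints of every index at
      once.\<close>
    define x where "x = rec_nat t c"
    have x: "x 0 = t" "x (Suc i) = c i (x i)" for i
      by (simp_all add: x_def)
    have "x i \<in> unit_interval" for i
      by (induction i) (use t c in \<open>simp_all only: x\<close>)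
    then have "x \<in> partial_limit g n"
      using c x(2) by (simp add: partial_limit_def)
    with x(1) show ?thesis by force
  qed
  then show ?thesis by (auto simp: partial_limit_def)
qed

text \<open>The new coordinate goes in front: the first constraint is peeled off and the tail obeys
  the shifted system. Hence the induction below varies \<open>g\<close>.\<close>

lemma partial_limit_Suc:
  assumes "weak_ivp_svf (g 0)"
  shows "partial_limit g (Suc n) =
    (\<lambda>(h, y). case_nat y h) ` {(h, y). h \<in> partial_limit (\<lambda>i. g (Suc i)) n \<and> y \<in> g 0 (h 0)}"
    (is "_ = ?c ` ?P")
proof
  show "partial_limit g (Suc n) \<subseteq> ?c ` ?P"
  proof
    fix x assume x: "x \<in> partial_limit g (Suc n)"
    then have "(\<lambda>i. x (Suc i), x 0) \<in> ?P" by (auto simp: partial_limit_def)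
    moreover have "x = ?c (\<lambda>i. x (Suc i), x 0)" by (auto simp: fun_eq_iff split: nat.split)
    ultimately show "x \<in> ?c ` ?P" by blast
  qed
  show "?c ` ?P \<subseteq> partial_limit g (Suc n)"
  proof clarify
    fix h y assume h: "h \<in> partial_limit (\<lambda>i. g (Suc i)) n" and y: "y \<in> g 0 (h 0)"
    then have "y \<in> unit_interval"
      using weak_ivp_svf.value_subset[OF assms, of "h 0"] unfolding partial_limit_def by blast
    with h y show "case_nat y h \<in> partial_limit g (Suc n)"
      by (auto simp: partial_limit_def less_Suc_eq_0_disj split: nat.split)
  qed
qed

lemma connected_partial_limit:
  assumes "\<And>i. weak_ivp_svf (g i)" "\<And>i. svf_surjective (g i)" "\<And>i. connected (svf_graph (g i))"
  shows "connected (partial_limit g n)"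
  using assms
proof (induction n arbitrary: g)
  case 0
  then show ?case using connected_cube by (simp add: partial_limit_def)
next
  case (Suc n)
  let ?H = "partial_limit (\<lambda>i. g (Suc i)) n"
  let ?P = "{(h, y). h \<in> ?H \<and> y \<in> g 0 (h 0)}"
  have H: "compact ?H" "connected ?H" "(\<lambda>x. x 0) ` ?H = unit_interval"
    using Suc by (auto intro!: compact_partial_limit partial_limit_coordinate)
  have c0: "continuous_on S (\<lambda>h :: nat \<Rightarrow> real. h 0)" for S
    by (rule continuous_on_subset[OF continuous_on_product_coordinates]) simp
  have "closed ((\<lambda>p :: (nat \<Rightarrow> real) \<times> real. (fst p 0, snd p)) -` svf_graph (g 0))"
    using weak_ivp_svf.compact_svf_graph[OF Suc.prems(1)]
    by (intro closed_vimage compact_imp_closed continuous_intros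
        continuous_on_compose2[OF c0]) auto
  moreover have h0: "h 0 \<in> unit_interval" if "h \<in> ?H" for h
    using that unfolding partial_limit_def by blast
  \<comment> \<open>The fibre product is the pullback of the closed graph along the first
    coordinate, inside a compact product.\<close>
  have "?P = (?H \<times> unit_interval) \<inter> ((\<lambda>p. (fst p 0, snd p)) -` svf_graph (g 0))"
    using h0 weak_ivp_svf.value_subset[OF Suc.prems(1), of _ 0]
    by (auto simp: weak_ivp_svf.svf_graph_iff[OF Suc.prems(1)] simp del: atLeastAtMost_iff)
  ultimately have "compact ?P"
    using H(1) by (simp add: compact_Int_closed compact_Times)
  then have "connected ?P"
    using weak_ivp_svf.connected_fibre_product[OF Suc.prems(1) H(1,2) c0 H(3) Suc.prems(3)] by simp
  moreover have "continuous_on S (\<lambda>p :: (nat \<Rightarrow> real) \<times> real. case p of (h, y) \<Rightarrow> case_nat y h)" for S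
  proof (rule continuous_on_coordinatewise_then_product)
    fix i
    show "continuous_on S (\<lambda>p :: (nat \<Rightarrow> real) \<times> real. (case p of (h, y) \<Rightarrow> case_nat y h) i)"
      using continuous_on_product_then_coordinatewise[OF continuous_on_fst[OF continuous_on_id]]
      by (cases i) (simp_all add: case_prod_beta continuous_on_snd continuous_on_id)
  qed
  ultimately show ?case
    unfolding partial_limit_Suc[OF Suc.prems(1)] by (rule connected_continuous_image[rotated])
qed

section \<open>Nested intersections and the inverse limit\<close>

text \<open>Disjoint open sets around the two pieces of a separation cannot cover the connected
  \<open>S n\<close>. The uncovered remainders are nested, nonempty and compact, so they share a
  point, which lies in neither piece.\<close>

lemma connected_decseq_Inter:
  fixes S :: "nat \<Rightarrow> 'a :: metric_space set"
  assumes cpt: "\<And>n. compact (S n)" and conn: "\<And>n. connected (S n)" and dec: "decseq S"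
  shows "connected (\<Inter>n. S n)"
proof (rule ccontr)
  assume "\<not> connected (\<Inter>n. S n)"
  moreover have "closed (\<Inter>n. S n)" using cpt compact_imp_closed by blast
  ultimately obtain A B where AB: "closed A" "closed B" "A \<noteq> {}" "B \<noteq> {}"
      "A \<union> B = (\<Inter>n. S n)" "A \<inter> B = {}"
    by (metis connected_closed_set)
  then obtain U V where UV: "open U" "open V" "A \<subseteq> U" "B \<subseteq> V" "U \<inter> V = {}"
    using t4_space by metis
  have "S n - (U \<union> V) \<noteq> {}" for n
  proof
    assume "S n - (U \<union> V) = {}"
    moreover have "A \<subseteq> S n" "B \<subseteq> S n" using AB(5) by auto
    ultimately show False
      using connectedD[OF conn[of n] UV(1,2)] UV(3-5) AB(3,4) by blast
  qed
  moreover have "closedin (top_of_set (S 0)) (S n - (U \<union> V))" for n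
  proof (rule closed_subset)
    show "S n - (U \<union> V) \<subseteq> S 0" using decseqD[OF dec, of 0 n] by blast
    show "closed (S n - (U \<union> V))"
      using UV(1,2) cpt by (intro closed_Diff open_Un compact_imp_closed)
  qed
  moreover have "decseq (\<lambda>n. S n - (U \<union> V))"
    using dec by (fastforce simp: decseq_def)
  moreover have "compact_space (top_of_set (S 0))"
    using cpt by (simp add: compact_space_subtopology)
  ultimately have "(\<Inter>n. S n - (U \<union> V)) \<noteq> {}"
    by (intro compact_space_imp_nest)
  then obtain x where "x \<in> (\<Inter>n. S n)" "x \<notin> U \<union> V" by blast
  with AB(5) UV(3,4) show False by blast
qed

theorem theorem3p5:
  fixes f :: "nat \<Rightarrow> real \<Rightarrow> real set"
  assumes "\<And>n. n \<ge> 1 \<Longrightarrow> f n \<in> unit_interval \<rightarrow> compact_hyperspace"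
    and "\<And>n. n \<ge> 1 \<Longrightarrow> svf_surjective (f n)"
    and "\<And>n. n \<ge> 1 \<Longrightarrow> upper_semicontinuous (f n)"
    and "\<And>n. n \<ge> 1 \<Longrightarrow> weak_intermediate_value_property (f n)"
    and "\<And>n. n \<ge> 1 \<Longrightarrow> connected (svf_graph (f n))"
  shows "connectedin hilbert_cube (inverse_limit f)"
proof -
  let ?g = "\<lambda>i. f (Suc i)"
  have g: "weak_ivp_svf (?g i)" for i
    using assms by (simp add: weak_ivp_svf_def)
  \<comment> \<open>As a subspace of the function space with its product topology, the cube lets
    \<open>connectedin\<close> reduce to \<open>connected\<close>.\<close>
  have cube: "hilbert_cube = top_of_set (PiE UNIV (\<lambda>_. unit_interval))"
    unfolding hilbert_cube_def
    using subtopology_product_topology[of "\<lambda>_. euclideanreal" "UNIV :: nat set" "\<lambda>_. unit_interval"]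
    by (simp add: euclidean_product_topology)
  have "inverse_limit f = {x. (\<forall>i. x i \<in> unit_interval) \<and> (\<forall>i. x i \<in> ?g i (x (Suc i)))}"
  proof -
    have "(\<forall>i\<ge>1. x (i - 1) \<in> f i (x i)) \<longleftrightarrow> (\<forall>i. x i \<in> ?g i (x (Suc i)))" for x
      by (metis One_nat_def Suc_le_D Suc_le_mono diff_Suc_1 le0)
    then show ?thesis by (auto simp: inverse_limit_def cube)
  qed
  also have "\<dots> = (\<Inter>n. partial_limit ?g n)"
    by (auto simp: partial_limit_def)
  finally have eq: "inverse_limit f = (\<Inter>n. partial_limit ?g n)" .
  have "connected (\<Inter>n. partial_limit ?g n)"
    using assms g
    by (intro connected_decseq_Inter compact_partial_limit connected_partial_limit)
      (auto simp: decseq_def partial_limit_def)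
  moreover have "(\<Inter>n. partial_limit ?g n) \<subseteq> PiE UNIV (\<lambda>_. unit_interval)"
    by (auto simp: partial_limit_def)
  ultimately show ?thesis
    by (simp add: eq cube connectedin_subtopology)
qed

end
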